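(* Let $\Delta t>0$ and $\Delta\tau>0$, and consider, at each solution point indexed by $(i_1,i_2,i_3)$ of the finite grid, the density component of the first-order BDF2 dual time-stepping update $$J_{i_1i_2i_3}\,\rho_1^{k+1}=C_2^{\tau}\left(J_{i_1i_2i_3}\Big(\rho_1^{k}+\tfrac{2\Delta\tau}{\Delta t}\rho_1^{n}-\tfrac{\Delta\tau}{2\Delta t}\rho_1^{n-1}\Big)-\Delta\tau\sum_{d=1}^{3}\frac{\hat{\bar f}^{\rho+}_{i_d}-\hat{\bar f}^{\rho-}_{i_d}}{\Delta\bar\xi_{i_d}}\right),\qquad C_2^{\tau}=\frac{2\Delta t}{2\Delta t+3\Delta\tau},$$ where all densities are evaluated at the point $(i_1,i_2,i_3)$ and the numerical fluxes are $$\hat{\bar f}^{\rho\pm}_{i_d}=\hat{\bar m}^{\pm}_{i_d}-\mathscr D^{\pm}_{i_d}\,\Delta^{\pm}_{i_d}\rho .$$ Assume that $\rho_1^k>0$ at all points (including the neighbouring values entering the fluxes), that $\rho_1^{k}+\frac{2\Delta\tau}{\Delta t}\rho_1^{n}-\frac{\Delta\tau}{2\Delta t}\rho_1^{n-1}>0$ at every solution point, and that for every solution point, every $d\in\{1,2,3\}$ and both signs, $$\mathscr D^{\pm}_{i_d}\ \ge\ \mathscr D^{\pm}_{i_d,\min}=\frac{|\hat{\bar m}^{\pm}_{i_d}|}{2\rho^{\pm}_{i_d,A}} .$$ If $$\Delta\tau<\Delta\tau^{\rho}:=\min_{i_1,i_2,i_3}\ \frac{1}{\displaystyle \frac{2}{J_{i_1i_2i_3}}\sum_{d=1}^{3}\frac{\mathscr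 D^{+}_{i_d}+\mathscr D^{-}_{i_d}}{\Delta\bar\xi_{i_d}}-\left(\frac{2}{\Delta t}\frac{\rho_1^{n}}{\rho_1^{k}}-\frac{1}{2\Delta t}\frac{\rho_1^{n-1}}{\rho_1^{k}}\right)}$$ (the denominators being nonzero, so that the right-hand side is defined), then the scheme preserves the positivity of density, i.e. $\rho_1^{k+1}>0$ at every solution point.
   Context: The scheme is a first-order finite-volume type discretization, on a finite three-dimensional tensor-product grid of Legendre-Gauss-Lobatto solution points in curvilinear computational coordinates $(\xi_1,\xi_2,\xi_3)$, of the regularized compressible Navier-Stokes equations. Only the continuity (density) equation is involved in this result. Notation. Superscripts $n$ and $n-1$ denote the (given) solution at the current and previous physical time levels; superscript $k$ denotes the current pseudotime iterate and $k+1$ the next one. $\rho_1^{n},\rho_1^{n-1},\rho_1^{k}$ are real-valued grid functions. $\Delta t$ is the physical time step and $\Delta\tau$ the pseudotime step. $J_{i_1i_2i_3}>0$ is the metric Jacobian at the solution point $(i_1,i_2,i_3)$. For a coordinate direction $d\in\{1,2,3\}$, the subscript $i_d$ indicates a quantity at the point $(i_1,i_2,i_3)$ relating to direction $d$, and $i_d\pm1$ the neighbouring point in direction $d$ (with the other two indices fixed; at an end of an element the neighbouring state is the exterior one, supplied by the adjacent element or the boundary data). $\Delta\bar\xi_{i_d}>0$ is the distance, in the computational domain, between the two consecutive flux points (control volume edges) that surround the solution point in direction $d$. All quantities in the fluxes are evaluated at pseudotime level $k$: $\Delta^{+}_{i_d}\rho=\rho_{i_d+1}-\rho_{i_d}$,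 $\ \Delta^{-}_{i_d}\rho=\rho_{i_d}-\rho_{i_d-1}$, $\ \rho^{\pm}_{i_d,A}=\tfrac12(\rho_{i_d}+\rho_{i_d\pm1})$, with $\rho=\rho_1^k$. The real number $\hat{\bar m}^{+}_{i_d}$ (resp. $\hat{\bar m}^{-}_{i_d}$) is the momentum (mass-flux component) of a two-point entropy conservative flux based on the states at $i_d$ and $i_d+1$ (resp. at $i_d-1$ and $i_d$); no property of it is used in the statement other than its being a given real number. The real numbers $\mathscr D^{\pm}_{i_d}$ are the dissipation coefficients. *)

theory Defs
  imports Complex_Main "HOL-Library.Numeral_Type"
begin

text \<open>
  Coordinate directions are the three elements of the type \<open>3\<close> (where \<open>3 = 0\<close>), so a
  multi-index \<open>(i\<^sub>1, i\<^sub>2, i\<^sub>3)\<close> is a function \<open>3 \<Rightarrow> nat\<close>.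
  Solution points carry indices \<open>1, \<dots>, N d\<close> in direction \<open>d\<close>. Grid functions are also
  read at the indices \<open>0\<close> and \<open>N d + 1\<close>: there they hold the exterior state, which comes
  from the adjacent element or from the boundary data and is not constrained here.
\<close>

type_synonym index = "3 \<Rightarrow> nat"

datatype side = Plus | Minus

definition solution_points :: "(3 \<Rightarrow> nat) \<Rightarrow> index set" where
  "solution_points N = {i. \<forall>d. i d \<in> {1..N d}}"

text \<open>On solution points \<open>i d \<ge> 1\<close>, so the subtraction on \<open>nat\<close> does not truncate.\<close>

fun neighbour :: "side \<Rightarrow> 3 \<Rightarrow> index \<Rightarrow> index" where
  "neighbour Plus d i = i(d := i d + 1)"
| "neighbour Minus d i = i(d := i d - 1)"

text \<open>
  The flux points in direction \<open>d\<close> are \<open>\<xi> d 0 < \<dots> < \<xi> d (N d)\<close>; the solution point with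
  index \<open>j\<close> sits between the flux points \<open>j - 1\<close> and \<open>j\<close>.
\<close>

definition flux_points :: "(3 \<Rightarrow> nat) \<Rightarrow> (3 \<Rightarrow> nat \<Rightarrow> real) \<Rightarrow> bool" where
  "flux_points N \<xi> \<longleftrightarrow> (\<forall>d. strict_mono_on {0..N d} (\<xi> d))"

definition cell_width :: "(3 \<Rightarrow> nat \<Rightarrow> real) \<Rightarrow> 3 \<Rightarrow> index \<Rightarrow> real" where
  "cell_width \<xi> d i = \<xi> d (i d) - \<xi> d (i d - 1)"

fun diff :: "(index \<Rightarrow> real) \<Rightarrow> side \<Rightarrow> 3 \<Rightarrow> index \<Rightarrow> real" where
  "diff \<rho> Plus d i = \<rho> (neighbour Plus d i) - \<rho> i"
| "diff \<rho> Minus d i = \<rho> i - \<rho> (neighbour Minus d i)"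

definition arith_mean :: "(index \<Rightarrow> real) \<Rightarrow> side \<Rightarrow> 3 \<Rightarrow> index \<Rightarrow> real" where
  "arith_mean \<rho> s d i = 1 / 2 * (\<rho> i + \<rho> (neighbour s d i))"

text \<open>
  In the following, \<open>m s d i\<close> is the momentum of the two-point entropy conservative flux and
  \<open>D s d i\<close> the dissipation coefficient, on side \<open>s\<close> of the point \<open>i\<close> in direction \<open>d\<close>.
\<close>

definition density_flux ::
  "(side \<Rightarrow> 3 \<Rightarrow> index \<Rightarrow> real) \<Rightarrow> (side \<Rightarrow> 3 \<Rightarrow> index \<Rightarrow> real) \<Rightarrow> (index \<Rightarrow> real)
    \<Rightarrow> side \<Rightarrow> 3 \<Rightarrow> index \<Rightarrow> real" where
  "density_flux m D \<rho> s d i = m s d i - D s d i * diff \<rho> s d i"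

definition min_dissipation ::
  "(side \<Rightarrow> 3 \<Rightarrow> index \<Rightarrow> real) \<Rightarrow> (index \<Rightarrow> real) \<Rightarrow> side \<Rightarrow> 3 \<Rightarrow> index \<Rightarrow> real" where
  "min_dissipation m \<rho> s d i = \<bar>m s d i\<bar> / (2 * arith_mean \<rho> s d i)"

definition flux_divergence ::
  "(3 \<Rightarrow> nat \<Rightarrow> real) \<Rightarrow> (side \<Rightarrow> 3 \<Rightarrow> index \<Rightarrow> real) \<Rightarrow> (side \<Rightarrow> 3 \<Rightarrow> index \<Rightarrow> real)
    \<Rightarrow> (index \<Rightarrow> real) \<Rightarrow> index \<Rightarrow> real" where
  "flux_divergence \<xi> m D \<rho> i =
     (\<Sum>d\<in>UNIV. (density_flux m D \<rho> Plus d i - density_flux m D \<rho> Minus d i) / cell_width \<xi> d i)"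

definition C2 :: "real \<Rightarrow> real \<Rightarrow> real" where
  "C2 \<Delta>t \<Delta>\<tau> = 2 * \<Delta>t / (2 * \<Delta>t + 3 * \<Delta>\<tau>)"

text \<open>
  In the following, \<open>\<rho>k\<close> is the density at the current pseudotime iterate, and \<open>\<rho>n\<close>, \<open>\<rho>p\<close>
  are the densities at the physical time levels \<open>n\<close> and \<open>n - 1\<close>.
\<close>

definition history_density ::
  "real \<Rightarrow> real \<Rightarrow> (index \<Rightarrow> real) \<Rightarrow> (index \<Rightarrow> real) \<Rightarrow> (index \<Rightarrow> real) \<Rightarrow> index \<Rightarrow> real" where
  "history_density \<Delta>t \<Delta>\<tau> \<rho>k \<rho>n \<rho>p i =
     \<rho>k i + 2 * \<Delta>\<tau> / \<Delta>t * \<rho>n i - \<Delta>\<tau> / (2 * \<Delta>t) * \<rho>p i"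

definition bound_denominator ::
  "(3 \<Rightarrow> nat \<Rightarrow> real) \<Rightarrow> (index \<Rightarrow> real) \<Rightarrow> (side \<Rightarrow> 3 \<Rightarrow> index \<Rightarrow> real) \<Rightarrow> real
    \<Rightarrow> (index \<Rightarrow> real) \<Rightarrow> (index \<Rightarrow> real) \<Rightarrow> (index \<Rightarrow> real) \<Rightarrow> index \<Rightarrow> real" where
  "bound_denominator \<xi> J D \<Delta>t \<rho>k \<rho>n \<rho>p i =
     2 / J i * (\<Sum>d\<in>UNIV. (D Plus d i + D Minus d i) / cell_width \<xi> d i)
     - (2 / \<Delta>t * (\<rho>n i / \<rho>k i) - 1 / (2 * \<Delta>t) * (\<rho>p i / \<rho>k i))"

definition pseudotime_bound ::
  "(3 \<Rightarrow> nat) \<Rightarrow> (3 \<Rightarrow> nat \<Rightarrow> real) \<Rightarrow> (index \<Rightarrow> real) \<Rightarrow> (side \<Rightarrow> 3 \<Rightarrow> index \<Rightarrow> real) \<Rightarrow> real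
    \<Rightarrow> (index \<Rightarrow> real) \<Rightarrow> (index \<Rightarrow> real) \<Rightarrow> (index \<Rightarrow> real) \<Rightarrow> real" where
  "pseudotime_bound N \<xi> J D \<Delta>t \<rho>k \<rho>n \<rho>p =
     (MIN i\<in>solution_points N. 1 / bound_denominator \<xi> J D \<Delta>t \<rho>k \<rho>n \<rho>p i)"

end

theory Submission
  imports Defs "HOL-Library.FuncSet"
begin

text \<open>
  The lower bound on the dissipation turns every two-point flux into
  \<open>\<bar>m\<bar> \<le> D (\<rho> i + \<rho> j)\<close>, so the neighbouring densities drop out of the flux difference, which is
  at most \<open>2 \<rho> (D\<^sup>+ + D\<^sup>-)\<close>. The bracket in the update is then at least
  \<open>J \<rho> (1 - \<Delta>\<tau> B)\<close> with \<open>B\<close> the denominator in the time step bound. As \<open>\<Delta>\<tau> > 0\<close> lies below the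
  minimum, \<open>1 / B > \<Delta>\<tau> > 0\<close> at every point, so \<open>B > 0\<close> and \<open>\<Delta>\<tau> B < 1\<close>.
\<close>

text \<open>\<open>MIN\<close> is a lower bound for its elements only over a finite set. Every
  function on the type \<open>3\<close> is extensional on \<open>UNIV\<close>, so the grid is a
  \<open>PiE\<close> product of finite intervals.\<close>

lemma finite_solution_points: "finite (solution_points N)"
proof -
  have "solution_points N = (\<Pi>\<^sub>E d\<in>UNIV. {1..N d})"
    by (auto simp: solution_points_def PiE_def)
  then show ?thesis
    by (simp add: finite_PiE)
qed

lemma cell_width_pos:
  assumes "flux_points N \<xi>" "i \<in> solution_points N"
  shows "cell_width \<xi> d i > 0"
proof -
  have "strict_mono_on {0..N d} (\<xi> d)"
    using assms(1) by (simp add: flux_points_def)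
  moreover have "i d \<in> {1..N d}"
    using assms(2) by (simp add: solution_points_def)
  \<comment> \<open>As \<open>i d\<close> is at least 1, \<open>i d - 1\<close> is a genuine
    predecessor and still lies in \<open>{0..N d}\<close>.\<close>
  ultimately have "\<xi> d (i d - 1) < \<xi> d (i d)"
    by (elim strict_mono_onD) auto
  then show ?thesis
    by (simp add: cell_width_def)
qed

lemma abs_momentum_le:
  assumes "\<rho> i > 0" "\<rho> (neighbour s d i) > 0" "D s d i \<ge> min_dissipation m \<rho> s d i"
  shows "\<bar>m s d i\<bar> \<le> D s d i * (\<rho> i + \<rho> (neighbour s d i))"
  using assms by (simp add: min_dissipation_def arith_mean_def field_simps)

text \<open>With \<rho>' the neighbouring density, the plus side gives m - D (\<rho>' - \<rho>)
  \<le> D (\<rho> + \<rho>') - D (\<rho>' - \<rho>) = 2 D \<rho>. The minus side, with m bounded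
  from below, gives -m + D (\<rho> - \<rho>') \<le> 2 D \<rho>.\<close>

lemma density_flux_difference_le:
  assumes "\<rho> i > 0" "\<And>s. \<rho> (neighbour s d i) > 0"
    and "\<And>s. D s d i \<ge> min_dissipation m \<rho> s d i"
  shows "density_flux m D \<rho> Plus d i - density_flux m D \<rho> Minus d i
    \<le> 2 * \<rho> i * (D Plus d i + D Minus d i)"
proof -
  have "m Plus d i \<le> D Plus d i * (\<rho> i + \<rho> (neighbour Plus d i))"
    using abs_momentum_le[of \<rho> i Plus d m D] assms by fastforce
  moreover have "- m Minus d i \<le> D Minus d i * (\<rho> i + \<rho> (neighbour Minus d i))"
    using abs_momentum_le[of \<rho> i Minus d m D] assms by fastforce
  ultimately show ?thesis
    unfolding density_flux_def diff.simps by argo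
qed

lemma flux_divergence_le:
  assumes "\<rho> i > 0" "\<And>s d. \<rho> (neighbour s d i) > 0" "\<And>d. cell_width \<xi> d i > 0"
    and "\<And>s d. D s d i \<ge> min_dissipation m \<rho> s d i"
  shows "flux_divergence \<xi> m D \<rho> i
    \<le> 2 * \<rho> i * (\<Sum>d\<in>UNIV. (D Plus d i + D Minus d i) / cell_width \<xi> d i)"
proof -
  have "flux_divergence \<xi> m D \<rho> i
      \<le> (\<Sum>d\<in>UNIV. 2 * \<rho> i * (D Plus d i + D Minus d i) / cell_width \<xi> d i)"
    unfolding flux_divergence_def
    by (intro sum_mono divide_right_mono density_flux_difference_le less_imp_le[OF assms(3)] assms)
  then show ?thesis
    by (simp add: sum_distrib_left)
qed

text \<open>Factoring out \<open>J i * \<rho>k i\<close> creates the ratios of densities and the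
  factor \<open>2 / J i\<close> in \<open>bound_denominator\<close>. This is an identity, so nothing
  is lost between the flux estimate and the time step bound.\<close>

lemma history_density_minus_dissipation:
  assumes "J i > 0" "\<rho>k i > 0" "\<Delta>t > 0"
  shows "J i * history_density \<Delta>t \<Delta>\<tau> \<rho>k \<rho>n \<rho>p i
      - \<Delta>\<tau> * (2 * \<rho>k i * (\<Sum>d\<in>UNIV. (D Plus d i + D Minus d i) / cell_width \<xi> d i))
    = J i * \<rho>k i * (1 - \<Delta>\<tau> * bound_denominator \<xi> J D \<Delta>t \<rho>k \<rho>n \<rho>p i)"
  using assms unfolding history_density_def bound_denominator_def
  by (simp add: field_simps)

lemma pseudotime_step_times_bound_denominator:
  assumes "i \<in> solution_points N" "\<Delta>\<tau> > 0" "\<Delta>\<tau> < pseudotime_bound N \<xi> J D \<Delta>t \<rho>k \<rho>n \<rho>p"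
  shows "\<Delta>\<tau> * bound_denominator \<xi> J D \<Delta>t \<rho>k \<rho>n \<rho>p i < 1"
proof -
  let ?B = "bound_denominator \<xi> J D \<Delta>t \<rho>k \<rho>n \<rho>p i"
  have "pseudotime_bound N \<xi> J D \<Delta>t \<rho>k \<rho>n \<rho>p \<le> 1 / ?B"
    unfolding pseudotime_bound_def
    using assms(1) by (intro Min_le) (auto simp: finite_solution_points)
  then have "\<Delta>\<tau> < 1 / ?B"
    using assms(3) by simp
  \<comment> \<open>The history terms leave the sign of \<open>?B\<close> open; it must be settled
    before multiplying by \<open>?B\<close>.\<close>
  moreover from this have "?B > 0"
    using assms(2) by (metis less_trans zero_less_divide_1_iff)
  ultimately show ?thesis
    by (simp add: pos_less_divide_eq)
qed

theorem theorem1: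
  fixes N :: "3 \<Rightarrow> nat"
    and \<xi> :: "3 \<Rightarrow> nat \<Rightarrow> real"
    and J :: "index \<Rightarrow> real"
    and m D :: "side \<Rightarrow> 3 \<Rightarrow> index \<Rightarrow> real"
    and \<rho>k \<rho>n \<rho>p \<rho>new :: "index \<Rightarrow> real"
    and \<Delta>t \<Delta>\<tau> :: real
  assumes "\<And>d. N d \<ge> 1"
    and "flux_points N \<xi>"
    and "\<And>i. i \<in> solution_points N \<Longrightarrow> J i > 0"
    and "\<Delta>t > 0"
    and "\<Delta>\<tau> > 0"
    and update: "\<And>i. i \<in> solution_points N \<Longrightarrow>
      J i * \<rho>new i = C2 \<Delta>t \<Delta>\<tau> *
        (J i * history_density \<Delta>t \<Delta>\<tau> \<rho>k \<rho>n \<rho>p i - \<Delta>\<tau> * flux_divergence \<xi> m D \<rho>k i)"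
    and "\<And>i. i \<in> solution_points N \<Longrightarrow> \<rho>k i > 0"
    and "\<And>i d s. i \<in> solution_points N \<Longrightarrow> \<rho>k (neighbour s d i) > 0"
    and "\<And>i. i \<in> solution_points N \<Longrightarrow> history_density \<Delta>t \<Delta>\<tau> \<rho>k \<rho>n \<rho>p i > 0"
    and "\<And>i d s. i \<in> solution_points N \<Longrightarrow> D s d i \<ge> min_dissipation m \<rho>k s d i"
    and "\<And>i. i \<in> solution_points N \<Longrightarrow> bound_denominator \<xi> J D \<Delta>t \<rho>k \<rho>n \<rho>p i \<noteq> 0"
    and "\<Delta>\<tau> < pseudotime_bound N \<xi> J D \<Delta>t \<rho>k \<rho>n \<rho>p"
  shows "\<forall>i\<in>solution_points N. \<rho>new i > 0"
proof
  fix i assume i: "i \<in> solution_points N"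
  let ?S = "\<Sum>d\<in>UNIV. (D Plus d i + D Minus d i) / cell_width \<xi> d i"
  let ?H = "history_density \<Delta>t \<Delta>\<tau> \<rho>k \<rho>n \<rho>p i"
  have J: "J i > 0" and \<rho>: "\<rho>k i > 0"
    using i assms by auto
  have "0 < J i * \<rho>k i * (1 - \<Delta>\<tau> * bound_denominator \<xi> J D \<Delta>t \<rho>k \<rho>n \<rho>p i)"
    using J \<rho> pseudotime_step_times_bound_denominator[OF i \<open>\<Delta>\<tau> > 0\<close> assms(12)] by simp
  also have "\<dots> = J i * ?H - \<Delta>\<tau> * (2 * \<rho>k i * ?S)"
    using history_density_minus_dissipation[of J i \<rho>k, OF J \<rho> \<open>\<Delta>t > 0\<close>] by simp
  \<comment> \<open>The divergence enters with the factor -\<Delta>\<tau>, so its upper bound yields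
    a lower bound for the bracket.\<close>
  also have "\<dots> \<le> J i * ?H - \<Delta>\<tau> * flux_divergence \<xi> m D \<rho>k i"
    using flux_divergence_le[of \<rho>k i \<xi> m D] cell_width_pos[OF assms(2) i] i assms(5,7,8,10)
    by (simp add: mult_left_mono)
  \<comment> \<open>\<open>C2 \<Delta>t \<Delta>\<tau>\<close> is positive because both time steps
    are, so the update keeps the sign of the bracket.\<close>
  finally have "J i * \<rho>new i > 0"
    using update[OF i] \<open>\<Delta>t > 0\<close> \<open>\<Delta>\<tau> > 0\<close> by (simp add: C2_def)
  then show "\<rho>new i > 0"
    using J by (simp add: zero_less_mult_iff)
qed

end
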